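(* Let $K$ be a number field, $\gamma, m \in K$, and $g_{\gamma,m}(x) = (x-\gamma)^2 + m + \gamma$. Define polynomials $t_i(x) \in K[x]$ by $t_1(x) = x + \gamma$ and $t_i(x) = (t_{i-1}(x) - \gamma)^2 + x + \gamma$ for $i \geq 2$. If for some $n \geq 1$ the iterate $g_{\gamma,m}^n(x)$ is irreducible over $K$ and $g_{\gamma,m}^{n+1}(x)$ is reducible over $K$, then there exists $y \in K$ such that $y^2 = t_{n+1}(m)$.
   Context: $g_{\gamma,m}^n$ denotes the $n$-fold composition of $g_{\gamma,m}$ with itself. *)

theory Defs
  imports "HOL-Computational_Algebra.Computational_Algebra"
begin

text \<open>A number field is given as a type: a field of characteristic 0 that is
  finite-dimensional as a vector space over the rationals.\<close>

definition number_field :: "'a::field_char_0 itself \<Rightarrow> bool" where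
  "number_field _ \<longleftrightarrow>
    (\<exists>B :: 'a set. finite_dimensional_vector_space (\<lambda>(q::rat) (x::'a). of_rat q * x) B)"

lemma number_field_rat: "number_field TYPE(rat)"
proof -
  have of_rat_id: "of_rat q = q" for q :: rat
    by (cases q) (simp add: of_rat_rat Fract_of_int_quotient)
  interpret V: vector_space "\<lambda>(q::rat) (x::rat). of_rat q * x"
    by unfold_locales (auto simp: algebra_simps of_rat_id)
  have "V.independent {1}"
    by (rule V.independent_insertI) (unfold V.span_empty, simp, rule V.independent_empty)
  moreover have "x \<in> V.span {1}" for x
    using V.span_scale[OF V.span_base[of 1 "{1}"], of x] by (simp add: of_rat_id)
  then have "V.span {1} = UNIV"
    by blast
  ultimately have "finite_dimensional_vector_space (\<lambda>(q::rat) (x::rat). of_rat q * x) {1}"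
    by unfold_locales (simp, blast+)
  then show ?thesis
    unfolding number_field_def by blast
qed

definition g_poly :: "'a::comm_ring_1 \<Rightarrow> 'a \<Rightarrow> 'a poly" where
  "g_poly \<gamma> m = ([:0, 1:] - [:\<gamma>:])\<^sup>2 + [:m:] + [:\<gamma>:]"

definition poly_iterate :: "'a::comm_ring_1 poly \<Rightarrow> nat \<Rightarrow> 'a poly" where
  "poly_iterate p n = (pcompose p ^^ n) [:0, 1:]"

text \<open>The sequence starts at index 1; the value at index 0 is a dummy.\<close>

fun t_poly :: "'a::comm_ring_1 \<Rightarrow> nat \<Rightarrow> 'a poly" where
  "t_poly \<gamma> 0 = [:\<gamma>:]"
| "t_poly \<gamma> (Suc 0) = [:0, 1:] + [:\<gamma>:]"
| "t_poly \<gamma> (Suc (Suc i)) = (t_poly \<gamma> (Suc i) - [:\<gamma>:])\<^sup>2 + [:0, 1:] + [:\<gamma>:]"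

end

theory Submission
  imports Defs
begin

text \<open>Write \<open>g\<^sup>n(x + m + \<gamma>) = Q(x)\<close>, so that \<open>g\<^sup>n\<^sup>+\<^sup>1(x + \<gamma>) = Q(x\<^sup>2)\<close> and \<open>t\<^sub>n\<^sub>+\<^sub>1(m) = Q(0)\<close>.
  If \<open>Q(x\<^sup>2) = A(x) B(x)\<close> properly, then \<open>A(x) A(-x) = N(x\<^sup>2)\<close> and \<open>B(x) B(-x) = M(x\<^sup>2)\<close>
  with \<open>N M = Q\<^sup>2\<close>, so \<open>N\<close> is a constant multiple of the irreducible \<open>Q\<close>. As \<open>Q\<close> is monic of even
  degree, the constant is the square of the leading coefficient of \<open>A\<close>, and evaluating at \<open>0\<close>
  shows that \<open>Q(0)\<close> is a square.\<close>

lemma poly_even_odd_decomposition: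
  fixes p :: "'a::comm_ring_1 poly"
  obtains a b where "p = pcompose a [:0, 0, 1:] + [:0, 1:] * pcompose b [:0, 0, 1:]"
proof -
  have "\<exists>a b. p = pcompose a [:0, 0, 1:] + [:0, 1:] * pcompose b [:0, 0, 1:]"
  proof (induction p)
    case 0
    show ?case by (rule exI[of _ 0], rule exI[of _ 0]) simp
  next
    case (pCons c p)
    then obtain a b where "p = pcompose a [:0, 0, 1:] + [:0, 1:] * pcompose b [:0, 0, 1:]"
      by blast
    \<comment> \<open>Multiplying by x swaps the even and odd parts: x a(x^2) is odd, and x^2 b(x^2)
      joins the constant \<open>c\<close>.\<close>
    then have "pCons c p = pcompose (pCons c b) [:0, 0, 1:] + [:0, 1:] * pcompose a [:0, 0, 1:]"
      by (simp add: pcompose_pCons algebra_simps)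
    then show ?case by blast
  qed
  with that show thesis by blast
qed

text \<open>Reflection x -> -x flips only the sign of the odd part, so the product is the difference
  of squares a(x^2)^2 - x^2 b(x^2)^2.\<close>

lemma poly_mult_reflect_eq_pcompose_square:
  fixes p :: "'a::comm_ring_1 poly"
  obtains q where "p * pcompose p [:0, -1:] = pcompose q [:0, 0, 1:]"
proof -
  obtain a b where p: "p = pcompose a [:0, 0, 1:] + [:0, 1:] * pcompose b [:0, 0, 1:]"
    by (rule poly_even_odd_decomposition)
  have square: "pcompose [:0, 0, 1:] [:0, -1:] = [:0, 0, 1::'a:]"
    by (simp add: pcompose_pCons)
  have "pcompose p [:0, -1:] = pcompose a [:0, 0, 1:] - [:0, 1:] * pcompose b [:0, 0, 1:]"
    unfolding p pcompose_add pcompose_mult pcompose_assoc[symmetric] square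
    by (simp add: pcompose_pCons)
  then have "p * pcompose p [:0, -1:] =
      (pcompose a [:0, 0, 1:] + [:0, 1:] * pcompose b [:0, 0, 1:]) *
      (pcompose a [:0, 0, 1:] - [:0, 1:] * pcompose b [:0, 0, 1:])"
    using p by simp
  also have "\<dots> = pcompose (a * a - [:0, 1:] * (b * b)) [:0, 0, 1:]"
    by (simp add: pcompose_diff pcompose_mult pcompose_pCons algebra_simps)
  finally have "p * pcompose p [:0, -1:] = pcompose (a * a - [:0, 1:] * (b * b)) [:0, 0, 1:]" .
  with that show thesis .
qed

lemma pcompose_square_inject:
  fixes p q :: "'a::idom poly"
  assumes "pcompose p [:0, 0, 1:] = pcompose q [:0, 0, 1:]"
  shows "p = q"
proof -
  have "pcompose (p - q) [:0, 0, 1:] = 0"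
    using assms by (simp add: pcompose_diff)
  then show ?thesis
    using pcompose_eq_0[of "p - q" "[:0, 0, 1:]"] by simp
qed

lemma const_term_square_if_reducible_pcompose_square:
  fixes Q :: "'a::field poly"
  assumes irr: "irreducible Q" and monic: "lead_coeff Q = 1" and even: "even (degree Q)"
    and red: "\<not> irreducible (pcompose Q [:0, 0, 1:])"
  shows "\<exists>y. y\<^sup>2 = poly Q 0"
proof -
  let ?S = "[:0, 0, 1:] :: 'a poly" and ?R = "[:0, -1:] :: 'a poly"
  have "degree Q > 0"
    using irr is_unit_iff_degree[of Q] by (auto simp: irreducible_def)
  then have "degree (pcompose Q ?S) > 0"
    by (simp add: degree_pcompose)
  moreover from this have "pcompose Q ?S \<noteq> 0"
    by (metis degree_0 less_irrefl)
  ultimately have "pcompose Q ?S \<noteq> 0" "\<not> is_unit (pcompose Q ?S)"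
    by (simp_all add: is_unit_iff_degree)
  with red obtain A B where AB: "pcompose Q ?S = A * B" "\<not> is_unit A" "\<not> is_unit B"
    unfolding irreducible_def by blast
  have nz: "A \<noteq> 0" "B \<noteq> 0"
    using AB(1) \<open>pcompose Q ?S \<noteq> 0\<close> by auto
  obtain N where N: "A * pcompose A ?R = pcompose N ?S"
    by (rule poly_mult_reflect_eq_pcompose_square)
  obtain M where M: "B * pcompose B ?R = pcompose M ?S"
    by (rule poly_mult_reflect_eq_pcompose_square)
  \<comment> \<open>Both sides of \<open>N\<close> have twice these degrees. Hence \<open>N\<close>
    inherits from \<open>A\<close> that it is not a unit.\<close>
  have degN: "degree N = degree A"
    using arg_cong[OF N, of degree] nz
    by (simp add: degree_mult_eq pcompose_eq_0_iff degree_pcompose)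
  have degM: "degree M = degree B"
    using arg_cong[OF M, of degree] nz
    by (simp add: degree_mult_eq pcompose_eq_0_iff degree_pcompose)
  \<comment> \<open>By this invariance A(-x) B(-x) is also Q(x^2), so the two norms multiply to
    Q(x^2)^2.\<close>
  have "pcompose (pcompose Q ?S) ?R = pcompose Q ?S"
    by (simp add: pcompose_assoc[symmetric] pcompose_pCons)
  then have "pcompose (N * M) ?S = pcompose (Q * Q) ?S"
    using N[symmetric] M[symmetric] AB(1) by (simp add: pcompose_mult mult_ac)
  then have NM: "N * M = Q * Q"
    by (rule pcompose_square_inject)
  have nz': "N \<noteq> 0" "M \<noteq> 0"
    using NM irr by auto
  have nu: "\<not> is_unit N" "\<not> is_unit M"
    using AB(2,3) nz nz' degN degM by (simp_all add: is_unit_iff_degree)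
  have prime: "prime_elem Q"
    using irr by (rule field_poly_irreducible_imp_prime)
  \<comment> \<open>Otherwise the prime \<open>Q\<close> divides \<open>M\<close>; cancelling it
    leaves \<open>N * M' = Q\<close>. Here \<open>N\<close> is no unit, and neither is
    \<open>M'\<close>, since a unit \<open>M'\<close> would give \<open>Q dvd N\<close>.\<close>
  have dvd: "Q dvd N"
  proof (rule ccontr)
    assume "\<not> Q dvd N"
    then have "Q dvd M"
      using prime NM by (metis dvd_triv_left prime_elem_dvd_mult_iff)
    then obtain M' where "M = Q * M'" ..
    with NM irr have "N * M' = Q" by auto
    then have "N dvd Q" "\<not> is_unit M'"
      using \<open>\<not> Q dvd N\<close> by (auto simp: mult_unit_dvd_iff' dvd_mult_unit_iff)
    with irr \<open>N * M' = Q\<close> nu show False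
      using irreducibleD by blast
  qed
  then obtain c where c: "N = Q * c" ..
  with NM irr have "c * M = Q" by auto
  with irr nu have "is_unit c"
    using irreducibleD by blast
  then obtain k where k: "c = [:k:]" "k \<noteq> 0"
    by (metis is_unit_poly_iff dvd_0_left zero_neq_one)
  then have Nk: "N = smult k Q" using c by simp
  have "even (degree A)"
    using Nk k even degN by simp
  \<comment> \<open>The leading coefficient of A(-x) carries the sign (-1)^(deg A), which is 1 by
    evenness.\<close>
  have "lead_coeff N = lead_coeff A * lead_coeff A"
    using arg_cong[OF N, of lead_coeff] \<open>even (degree A)\<close> nz
    by (simp only: lead_coeff_mult) (simp add: lead_coeff_comp)
  then have "k = (lead_coeff A)\<^sup>2"
    using Nk k monic by (simp add: power2_eq_square)
  moreover have "(poly A 0)\<^sup>2 = poly N 0"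
    using arg_cong[OF N, of "\<lambda>p. poly p 0"] by (simp add: poly_pcompose power2_eq_square)
  ultimately have "(poly A 0 / lead_coeff A)\<^sup>2 = poly Q 0"
    using Nk k by (simp add: power_divide)
  then show ?thesis by blast
qed

text \<open>The substitution x -> x + a has the inverse x -> x - a, which carries any factorization
  back to \<open>p\<close> and preserves degrees.\<close>

lemma irreducible_pcompose_shift:
  fixes p :: "'a::field poly"
  assumes "irreducible p"
  shows "irreducible (pcompose p [:a, 1:])"
proof (rule irreducibleI)
  have "p \<noteq> 0" "degree p > 0"
    using assms is_unit_iff_degree[of p] by (auto simp: irreducible_def)
  then show "pcompose p [:a, 1:] \<noteq> 0" "\<not> is_unit (pcompose p [:a, 1:])"
    by (auto simp: is_unit_iff_degree pcompose_eq_0_iff degree_pcompose)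
next
  fix u v
  assume uv: "pcompose p [:a, 1:] = u * v"
  have "p = pcompose (pcompose p [:a, 1:]) [:-a, 1:]"
    by (simp add: pcompose_assoc[symmetric] pcompose_pCons)
  then have p: "p = pcompose u [:-a, 1:] * pcompose v [:-a, 1:]"
    by (simp add: uv pcompose_mult)
  then have "is_unit (pcompose u [:-a, 1:]) \<or> is_unit (pcompose v [:-a, 1:])"
    using assms irreducibleD by blast
  moreover have "u \<noteq> 0" "v \<noteq> 0"
    using p assms by auto
  ultimately show "is_unit u \<or> is_unit v"
    by (auto simp: is_unit_iff_degree pcompose_eq_0_iff degree_pcompose)
qed

text \<open>The definition adds the new copy of \<open>p\<close> outermost; here it is innermost,
  where the square in \<open>g_poly\<close> can be exposed by a shift.\<close>

lemma poly_iterate_Suc_right: "poly_iterate p (Suc n) = pcompose (poly_iterate p n) p"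
  by (induction n) (simp_all add: poly_iterate_def pcompose_assoc pcompose_pCons)

lemma g_poly_eq_pcompose: "g_poly \<gamma> m = pcompose [:m + \<gamma>, 0, 1:] [:-\<gamma>, 1:]"
  by (simp add: g_poly_def pcompose_pCons power2_eq_square algebra_simps)

lemma g_poly_degree_lead_coeff:
  fixes \<gamma> m :: "'a::idom"
  shows "degree (g_poly \<gamma> m) = 2" "lead_coeff (g_poly \<gamma> m) = 1"
proof -
  show "degree (g_poly \<gamma> m) = 2"
    by (simp add: g_poly_eq_pcompose degree_pcompose)
  show "lead_coeff (g_poly \<gamma> m) = 1"
    unfolding g_poly_eq_pcompose by (subst lead_coeff_comp) simp_all
qed

lemma poly_iterate_g_poly_degree_lead_coeff:
  fixes \<gamma> m :: "'a::idom"
  shows "degree (poly_iterate (g_poly \<gamma> m) n) = 2 ^ n"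
    and "lead_coeff (poly_iterate (g_poly \<gamma> m) n) = 1"
proof -
  show "degree (poly_iterate (g_poly \<gamma> m) n) = 2 ^ n"
    by (induction n) (simp_all add: poly_iterate_def g_poly_degree_lead_coeff degree_pcompose)
  show "lead_coeff (poly_iterate (g_poly \<gamma> m) n) = 1"
  proof (induction n)
    case (Suc n)
    then show ?case
      unfolding poly_iterate_Suc_right
      using g_poly_degree_lead_coeff[of \<gamma> m] by (subst lead_coeff_comp) simp_all
  qed (simp add: poly_iterate_def)
qed

text \<open>At x = m the recursion for t is an application of g, starting from t_1(m) = m +
  \<gamma>; hence index n + 1 matches n iterations.\<close>

lemma poly_t_poly_Suc: "poly (t_poly \<gamma> (Suc n)) m = poly (poly_iterate (g_poly \<gamma> m) n) (m + \<gamma>)"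
  by (induction n) (simp_all add: poly_iterate_def poly_pcompose g_poly_def)

theorem theorem4p1:
  fixes \<gamma> m :: "'a::field_char_0" and n :: nat
  assumes "number_field TYPE('a)"
    and "n \<ge> 1"
    and "irreducible (poly_iterate (g_poly \<gamma> m) n)"
    and "\<not> irreducible (poly_iterate (g_poly \<gamma> m) (n + 1))"
  shows "\<exists>y::'a. y\<^sup>2 = poly (t_poly \<gamma> (n + 1)) m"
proof -
  let ?P = "poly_iterate (g_poly \<gamma> m) n"
  define Q where "Q = pcompose ?P [:m + \<gamma>, 1:]"
  have "irreducible Q"
    unfolding Q_def using assms(3) by (rule irreducible_pcompose_shift)
  moreover have "lead_coeff Q = 1"
    using poly_iterate_g_poly_degree_lead_coeff(2)[of \<gamma> m n]
    unfolding Q_def by (subst lead_coeff_comp) simp_all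
  \<comment> \<open>The degree is 2^n, which is even because n \<ge> 1.\<close>
  moreover have "even (degree Q)"
    using assms(2) by (simp add: Q_def poly_iterate_g_poly_degree_lead_coeff degree_pcompose)
  moreover have "\<not> irreducible (pcompose Q [:0, 0, 1:])"
  proof
    assume "irreducible (pcompose Q [:0, 0, 1:])"
    \<comment> \<open>Shifting by -\<gamma> turns x^2 + m + \<gamma> into g, and so Q(x^2) into the
      reducible iterate.\<close>
    then have "irreducible (pcompose (pcompose Q [:0, 0, 1:]) [:-\<gamma>, 1:])"
      by (rule irreducible_pcompose_shift)
    moreover have "pcompose (pcompose Q [:0, 0, 1:]) [:-\<gamma>, 1:] = poly_iterate (g_poly \<gamma> m) (n + 1)"
      by (simp add: Q_def poly_iterate_Suc_right g_poly_eq_pcompose pcompose_assoc[symmetric]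
          pcompose_pCons)
    ultimately show False
      using assms(4) by simp
  qed
  ultimately have "\<exists>y. y\<^sup>2 = poly Q 0"
    by (rule const_term_square_if_reducible_pcompose_square)
  then show ?thesis
    by (simp add: Q_def poly_pcompose poly_t_poly_Suc)
qed

end
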